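(* Let $\mathcal A=\{1,\dots,d\}$ and $a\in\mathcal A$. If $(w^{(n)})_{n\in\mathbb N}$ is a sequence of $C$-balanced sequences (in $\mathcal A^{\mathbb N}$) converging to a $C$-balanced sequence $w$, then $$\mathcal R_a(w)\subseteq\operatorname{Li}_{n\to\infty}\mathcal R_a(w^{(n)}).$$
   Context: $\mathcal A^{\mathbb N}$ has the product topology, with $\mathcal A$ discrete. A sequence $x\in\mathcal A^{\mathbb N}$ is called $C$-balanced if there exists a constant $C\ge1$ such that $\bigl||x_{[j,j+n-1]}|_b-|x_{[k,k+n-1]}|_b\bigr|\le C$ for all $j,k,n\in\mathbb N$ and $b\in\mathcal A$, where $x_{[i,j]}=x_i\cdots x_j$ (the empty word if $j<i$) and $|u|_b$ is the number of occurrences of the letter $b$ in the finite word $u$. Every $C$-balanced sequence $x$ has a letter frequency vector, whose $i$-th entry is $\lim_{n\to\infty}\frac1n|x_{[j_n,j_n+n-1]}|_i$; this limit exists and is the same for all sequences $(j_n)_n$ of positive integers. Let $\mathbf v$ be the letter frequency vector of the $C$-balanced sequence $w$, let $\mathbb H\subset\mathbb R^d$ be a $(d-1)$-dimensional hyperplane through the origin such that every non-zero vector of $\mathbb H$ is linearly independent of $\mathbf v$, and let $\pi:\mathbb R^d\to\mathbb R^d$ be the linear projection along $\mathbf v$ onto $\mathbb H$. Let $\psi(u)=(|u|_1,\dots,|u|_d)^T$ be the abelianisation vector of a finite word $u$. For a sequence $x\in\mathcal A^{\mathbb N}$ put $$\mathcal S_a(x)=\{\psi(x_{[1,n]}):n\in\mathbb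 N_0,\ x_{n+1}=a\},\qquad \mathcal R_a(x)=\overline{\pi(\mathcal S_a(x))}.$$ For a sequence of sets $A_n$ in a metric space with metric $\rho$ (here $\mathbb H$ with the metric induced by a norm), the Kuratowski–Painlevé limit inferior is $\operatorname{Li}_{n\to\infty}A_n=\{x:\limsup_{n\to\infty}\rho(x,A_n)=0\}$, where $\rho(x,A)=\inf\{\rho(x,y):y\in A\}$ (with $\inf\emptyset=\infty$). *)

theory Defs
  imports "HOL-Analysis.Analysis" "HOL-Real_Asymp.Real_Asymp"
begin

text \<open>The alphabet $\{1,\dots,d\}$ is a finite type \<open>'d\<close>, so \<open>d = CARD('d)\<close> and
  $\mathbb R^d$ is \<open>real ^ 'd\<close>.  Sequences are indexed from 0: the letter $x_{i+1}$ is \<open>x i\<close>.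
  Hence \<open>factor x j n\<close>, the word of length \<open>n\<close> starting at position \<open>j\<close>,
  is $x_{[j+1,\,j+n]}$, and the prefix $x_{[1,n]}$ is \<open>factor x 0 n\<close>.\<close>

definition factor :: "(nat \<Rightarrow> 'd) \<Rightarrow> nat \<Rightarrow> nat \<Rightarrow> 'd list" where
  "factor x j n = map x [j..<j + n]"

definition seq_topology :: "(nat \<Rightarrow> 'd) topology" where
  "seq_topology = product_topology (\<lambda>_. discrete_topology UNIV) UNIV"

text \<open>The constant is existentially quantified for each sequence separately, so it need not be
  uniform over a family of balanced sequences.\<close>

definition balanced :: "(nat \<Rightarrow> 'd) \<Rightarrow> bool" where
  "balanced x \<longleftrightarrow> (\<exists>C::real. C \<ge> 1 \<and> (\<forall>j k n b.
     \<bar>real (count_list (factor x j n) b) - real (count_list (factor x k n) b)\<bar> \<le> C))"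

definition is_letter_freq :: "(nat \<Rightarrow> 'd::finite) \<Rightarrow> real ^ 'd \<Rightarrow> bool" where
  "is_letter_freq x v \<longleftrightarrow> (\<forall>j :: nat \<Rightarrow> nat. \<forall>i.
     (\<lambda>n. real (count_list (factor x (j n) n) i) / real n) \<longlonglongrightarrow> v $ i)"

definition abelianisation :: "'d list \<Rightarrow> real ^ 'd::finite" where
  "abelianisation u = (\<chi> b. real (count_list u b))"

definition hyperplane_through_0 :: "(real ^ 'd::finite) set \<Rightarrow> bool" where
  "hyperplane_through_0 H \<longleftrightarrow> subspace H \<and> dim H = CARD('d) - 1"

text \<open>The conjunct \<open>h \<noteq> v\<close> is needed because \<open>{h, v}\<close> collapses to a singleton when \<open>h = v\<close>.\<close>

definition lin_indep_pair :: "real ^ 'd::finite \<Rightarrow> real ^ 'd \<Rightarrow> bool" where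
  "lin_indep_pair h v \<longleftrightarrow> h \<noteq> v \<and> independent {h, v}"

definition projection_along ::
    "real ^ 'd::finite \<Rightarrow> (real ^ 'd) set \<Rightarrow> (real ^ 'd \<Rightarrow> real ^ 'd) \<Rightarrow> bool" where
  "projection_along v H p \<longleftrightarrow>
     linear p \<and> range p = H \<and> (\<forall>h\<in>H. p h = h) \<and> {y. p y = 0} = span {v}"

definition S_set :: "'d::finite \<Rightarrow> (nat \<Rightarrow> 'd) \<Rightarrow> (real ^ 'd) set" where
  "S_set a x = {abelianisation (factor x 0 n) | n. x n = a}"

definition R_set ::
    "(real ^ 'd::finite \<Rightarrow> real ^ 'd) \<Rightarrow> 'd \<Rightarrow> (nat \<Rightarrow> 'd) \<Rightarrow> (real ^ 'd) set" where
  "R_set p a x = closure (p ` S_set a x)"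

definition norm_on :: "'v::real_vector set \<Rightarrow> ('v \<Rightarrow> real) \<Rightarrow> bool" where
  "norm_on H N \<longleftrightarrow>
     (\<forall>x\<in>H. 0 \<le> N x \<and> (N x = 0 \<longleftrightarrow> x = 0)) \<and>
     (\<forall>x\<in>H. \<forall>c. N (c *\<^sub>R x) = \<bar>c\<bar> * N x) \<and>
     (\<forall>x\<in>H. \<forall>y\<in>H. N (x + y) \<le> N x + N y)"

text \<open>The infimum is taken in \<open>ereal\<close>, so that the distance to the empty set is \<open>\<infinity>\<close>.\<close>

definition point_set_dist :: "('v \<Rightarrow> 'v \<Rightarrow> real) \<Rightarrow> 'v \<Rightarrow> 'v set \<Rightarrow> ereal" where
  "point_set_dist \<rho> x A = (INF y\<in>A. ereal (\<rho> x y))"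

definition KP_liminf :: "'v set \<Rightarrow> ('v \<Rightarrow> 'v \<Rightarrow> real) \<Rightarrow> (nat \<Rightarrow> 'v set) \<Rightarrow> 'v set" where
  "KP_liminf X \<rho> A = {x\<in>X. limsup (\<lambda>n. point_set_dist \<rho> x (A n)) = 0}"

lemma count_factor_add:
  "count_list (factor x j (m + n)) b
     = count_list (factor x j m) b + count_list (factor x (j + m) n) b"
proof -
  have "[j..<j + (m + n)] = [j..<j + m] @ [j + m..<j + m + n]"
    using upt_add_eq_append[of j "j + m" n] by (simp add: add.assoc)
  then show ?thesis by (simp add: factor_def)
qed

lemma balanced_imp_letter_freq:
  fixes x :: "nat \<Rightarrow> 'd::finite"
  assumes "balanced x"
  shows "\<exists>!v. is_letter_freq x v"
proof -
  obtain C :: real where C1: "C \<ge> 1" and C: "\<And>j k n b.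
      \<bar>real (count_list (factor x j n) b) - real (count_list (factor x k n) b)\<bar> \<le> C"
    using assms unfolding balanced_def by blast
  define c where "c b j n = real (count_list (factor x j n) b)" for b j n
  have Cc: "\<bar>c b j n - c b k n\<bar> \<le> C" for b j k n using C by (simp add: c_def)
  have cadd: "c b j (m + n) = c b j m + c b (j + m) n" for b j m n
    by (simp add: c_def count_factor_add)
  have mult: "\<bar>c b 0 (m * n) - real m * c b 0 n\<bar> \<le> real m * C" for b m n
  proof (induction m)
    case 0
    show ?case by (simp add: c_def factor_def)
  next
    case (Suc m)
    have "c b 0 (Suc m * n) = c b 0 (m * n) + c b (m * n) n"
      using cadd[of b 0 "m * n" n] by (simp add: add.commute)
    then show ?case using Suc Cc[of b "m * n" n 0] by (simp add: algebra_simps abs_le_iff)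
  qed
  have scaled: "\<bar>c b 0 (m * n) / (real m * real n) - c b 0 n / real n\<bar> \<le> C / real n"
    if "m > 0" "n > 0" for b m n
  proof -
    have "c b 0 (m * n) / (real m * real n) - c b 0 n / real n
        = (c b 0 (m * n) - real m * c b 0 n) / (real m * real n)"
      using that by (simp add: field_simps)
    also have "\<bar>\<dots>\<bar> \<le> (real m * C) / (real m * real n)"
      using divide_right_mono[OF mult[of b m n], of "real m * real n"]
      by (simp add: abs_divide abs_mult del: times_divide_eq_left times_divide_eq_right
          mult_divide_mult_cancel_left_if)
    finally show ?thesis using that by simp
  qed
  have diff: "\<bar>c b 0 m / real m - c b 0 n / real n\<bar> \<le> C / real m + C / real n"
    if "m > 0" "n > 0" for b m n
    using scaled[of m n b] scaled[of n m b] that by (simp add: mult.commute)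
  have Cn0: "(\<lambda>n. C / real n) \<longlonglongrightarrow> 0" by real_asymp
  have "Cauchy (\<lambda>n. c b 0 n / real n)" for b
  proof (rule metric_CauchyI)
    fix e :: real assume "e > 0"
    then have "eventually (\<lambda>n. C / real n < e / 2) sequentially"
      using order_tendstoD(2)[OF Cn0, of "e / 2"] by simp
    then obtain M where M: "\<And>n. n \<ge> M \<Longrightarrow> C / real n < e / 2"
      by (auto simp: eventually_sequentially)
    show "\<exists>M. \<forall>m\<ge>M. \<forall>n\<ge>M. dist (c b 0 m / real m) (c b 0 n / real n) < e"
    proof (intro exI allI impI)
      fix m n assume mn: "m \<ge> Suc M" "n \<ge> Suc M"
      then have "m > 0" "n > 0" "C / real m < e / 2" "C / real n < e / 2"
        using M[of m] M[of n] by auto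
      then show "dist (c b 0 m / real m) (c b 0 n / real n) < e"
        using diff[of m n b] unfolding dist_real_def by linarith
    qed
  qed
  then obtain l where l: "\<And>b. (\<lambda>n. c b 0 n / real n) \<longlonglongrightarrow> l b"
    unfolding Cauchy_convergent_iff convergent_def by metis
  have lim: "(\<lambda>n. c b (j n) n / real n) \<longlonglongrightarrow> l b" for b j
  proof -
    have "(\<lambda>n. (c b (j n) n - c b 0 n) / real n) \<longlonglongrightarrow> 0"
    proof (rule Lim_null_comparison[OF _ Cn0])
      show "\<forall>\<^sub>F n in sequentially. norm ((c b (j n) n - c b 0 n) / real n) \<le> C / real n"
        using Cc by (intro always_eventually) (simp add: abs_divide divide_right_mono)
    qed
    from tendsto_add[OF this l[of b]] show ?thesis by (simp add: diff_divide_distrib)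
  qed
  show ?thesis
  proof (rule ex1I[of _ "\<chi> i. l i"])
    show "is_letter_freq x (\<chi> i. l i)"
      using lim by (simp add: is_letter_freq_def c_def)
    fix v assume "is_letter_freq x v"
    then have "(\<lambda>n. c i 0 n / real n) \<longlonglongrightarrow> v $ i" for i
      unfolding is_letter_freq_def c_def by (auto dest: spec[of _ "\<lambda>_. 0"])
    then show "v = (\<chi> i. l i)"
      using LIMSEQ_unique[OF _ l] by (auto simp: vec_eq_iff)
  qed
qed

end

theory Submission
  imports Defs
begin

text \<open>
  Each vector of \<open>S_set a w\<close> is determined by a finite prefix of \<open>w\<close>: it is the abelianisation of
  the word before an occurrence of \<open>a\<close>, so it depends only on the letters up to and including that
  occurrence.  Convergence in the product of discrete topologies means that every finite prefix is
  eventually constant, hence every single vector of \<open>S_set a w\<close> eventually lies in \<open>S_set a (ws n)\<close>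
  (lemma \<open>eventually_mem_S_set\<close>).  A point \<open>x\<close> of \<open>R_set p a w\<close> is Euclidean-close to some
  projected vector of this kind, and on the finite-dimensional space \<open>H\<close> the norm \<open>N\<close> is dominated
  by the Euclidean norm (lemma \<open>norm_on_le_norm\<close>); so the distance from \<open>x\<close> to the sets
  \<open>R_set p a (ws n)\<close>, measured by \<open>N\<close>, is eventually below every positive bound.
\<close>

lemma eventually_same_prefix:
  assumes "limitin seq_topology ws w F"
  shows "\<forall>\<^sub>F n in F. \<forall>i<m. ws n i = w i"
proof -
  have "\<forall>\<^sub>F n in F. ws n i = w i" for i
  proof -
    have "limitin (discrete_topology UNIV) (\<lambda>n. ws n i) (w i) F"
      using assms by (simp add: seq_topology_def limitin_componentwise)
    from limitinD[OF this, of "{w i}"] show ?thesis by simp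
  qed
  then show ?thesis
    using eventually_ball_finite[of "{..<m}" "\<lambda>n i. ws n i = w i" F] by (simp add: Ball_def)
qed

lemma eventually_mem_S_set:
  assumes "limitin seq_topology ws w F" and "s \<in> S_set a w"
  shows "\<forall>\<^sub>F n in F. s \<in> S_set a (ws n)"
proof -
  obtain m where s: "s = abelianisation (factor w 0 m)" and m: "w m = a"
    using assms(2) by (auto simp: S_set_def)
  \<comment> \<open>The prefix must include position \<open>m\<close> itself, where the letter \<open>a\<close> occurs.\<close>
  show ?thesis
    using eventually_same_prefix[OF assms(1), of "Suc m"]
  proof eventually_elim
    case (elim n)
    then have "factor (ws n) 0 m = factor w 0 m" "ws n m = a"
      using m by (auto simp: factor_def)
    then show ?case using s unfolding S_set_def by force
  qed
qed

lemma norm_on_sum_le: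
  assumes N: "norm_on H N" and H: "subspace H" and f: "\<And>b. b \<in> B \<Longrightarrow> f b \<in> H"
  shows "N (\<Sum>b\<in>B. f b) \<le> (\<Sum>b\<in>B. N (f b))"
proof -
  have zero: "N 0 = 0"
    using N subspace_0[OF H] by (simp add: norm_on_def)
  show ?thesis
    using f
  proof (induction B rule: infinite_finite_induct)
    case (insert b B)
    have "sum f B \<in> H"
      using insert.prems by (intro subspace_sum[OF H]) auto
    then have "N (f b + sum f B) \<le> N (f b) + N (sum f B)"
      using N insert.prems by (simp add: norm_on_def)
    with insert show ?case by force
  qed (simp_all add: zero)
qed

text \<open>Expanding \<open>h\<close> in an orthonormal basis of \<open>H\<close>, whose coordinates are bounded by \<open>norm h\<close>,
  reduces the bound to the finitely many values of \<open>N\<close> on the basis.\<close>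

lemma norm_on_le_norm:
  fixes H :: "'v::euclidean_space set"
  assumes N: "norm_on H N" and H: "subspace H"
  obtains K where "K > 0" and "\<And>h. h \<in> H \<Longrightarrow> N h \<le> K * norm h"
proof -
  obtain B where B: "B \<subseteq> H" "pairwise orthogonal B" "\<And>b. b \<in> B \<Longrightarrow> norm b = 1"
      "independent B" "span B = H"
    using orthonormal_basis_subspace[OF H] by metis
  have fin: "finite B" using B(4) by (rule independent_imp_finite)
  have nonneg: "0 \<le> N b" if "b \<in> B" for b
    using N B(1) that by (auto simp: norm_on_def)
  have bound: "N h \<le> (\<Sum>b\<in>B. N b) * norm h" if "h \<in> H" for h
  proof -
    have "N h = N (\<Sum>b\<in>B. (h \<bullet> b) *\<^sub>R b)"
      using orthonormal_basis_expand[OF B(2,3) _ fin, of h] B(5) that by simp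
    also have "\<dots> \<le> (\<Sum>b\<in>B. N ((h \<bullet> b) *\<^sub>R b))"
      using B(1) by (intro norm_on_sum_le[OF N H] subspace_scale[OF H]) auto
    also have "\<dots> = (\<Sum>b\<in>B. \<bar>h \<bullet> b\<bar> * N b)"
      using N B(1) by (intro sum.cong) (auto simp: norm_on_def)
    also have "\<dots> \<le> (\<Sum>b\<in>B. norm h * N b)"
    proof (intro sum_mono mult_right_mono)
      show "\<bar>h \<bullet> b\<bar> \<le> norm h" if "b \<in> B" for b
        using Cauchy_Schwarz_ineq2[of h b] B(3)[OF that] by simp
    qed (rule nonneg)
    finally show ?thesis by (simp add: sum_distrib_left mult.commute)
  qed
  show thesis
  proof (rule that)
    \<comment> \<open>The summand 1 keeps the constant positive when \<open>H\<close> is trivial.\<close>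
    show "(\<Sum>b\<in>B. N b) + 1 > 0"
      using sum_nonneg[of B N] nonneg by fastforce
    show "N h \<le> ((\<Sum>b\<in>B. N b) + 1) * norm h" if "h \<in> H" for h
      using bound[OF that] by (simp add: distrib_right add_increasing2)
  qed
qed

lemma R_set_subset_range:
  assumes "range p = H" and "subspace H"
  shows "R_set p a x \<subseteq> H"
  unfolding R_set_def using assms by (intro closure_minimal closed_subspace) auto

lemma mem_KP_liminfI:
  assumes x: "x \<in> X"
    and nonneg: "\<And>n y. y \<in> A n \<Longrightarrow> 0 \<le> \<rho> x y"
    and close: "\<And>e::real. e > 0 \<Longrightarrow> \<forall>\<^sub>F n in sequentially. \<exists>y\<in>A n. \<rho> x y \<le> e"
  shows "x \<in> KP_liminf X \<rho> A"
proof -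
  have "0 \<le> point_set_dist \<rho> x (A n)" for n
    using nonneg by (auto simp: point_set_dist_def intro!: INF_greatest)
  then have "0 \<le> limsup (\<lambda>n. point_set_dist \<rho> x (A n))"
    by (intro le_Limsup always_eventually) auto
  moreover have "limsup (\<lambda>n. point_set_dist \<rho> x (A n)) \<le> 0"
  proof (rule ereal_le_epsilon2)
    fix e :: real assume "e > 0"
    from close[OF this]
    have "\<forall>\<^sub>F n in sequentially. point_set_dist \<rho> x (A n) \<le> ereal e"
      by eventually_elim (auto simp: point_set_dist_def intro: INF_lower2)
    then show "limsup (\<lambda>n. point_set_dist \<rho> x (A n)) \<le> 0 + ereal e"
      by (simp add: Limsup_bounded)
  qed
  ultimately show ?thesis
    using x by (simp add: KP_liminf_def)
qed

theorem lemma3p5: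
  fixes a :: "'d::finite"
    and w :: "nat \<Rightarrow> 'd"
    and ws :: "nat \<Rightarrow> nat \<Rightarrow> 'd"
    and v :: "real ^ 'd"
    and H :: "(real ^ 'd) set"
    and p :: "real ^ 'd \<Rightarrow> real ^ 'd"
    and N :: "real ^ 'd \<Rightarrow> real"
  assumes "balanced w"
    and "\<And>n. balanced (ws n)"
    and "limitin seq_topology ws w sequentially"
    and "is_letter_freq w v"
    and "hyperplane_through_0 H"
    and "\<And>h. h \<in> H \<Longrightarrow> h \<noteq> 0 \<Longrightarrow> lin_indep_pair h v"
    and "projection_along v H p"
    and "norm_on H N"
  shows "R_set p a w \<subseteq> KP_liminf H (\<lambda>x y. N (x - y)) (\<lambda>n. R_set p a (ws n))"
proof
  fix x assume x: "x \<in> R_set p a w"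
  have H: "subspace H" using assms(5) by (simp add: hyperplane_through_0_def)
  have p: "range p = H" using assms(7) by (simp add: projection_along_def)
  have R: "R_set p a u \<subseteq> H" for u by (rule R_set_subset_range[OF p H])
  have xH: "x \<in> H" using x R by blast
  obtain K where K: "K > 0" "\<And>h. h \<in> H \<Longrightarrow> N h \<le> K * norm h"
    using norm_on_le_norm[OF assms(8) H] by blast
  show "x \<in> KP_liminf H (\<lambda>x y. N (x - y)) (\<lambda>n. R_set p a (ws n))"
  proof (rule mem_KP_liminfI[OF xH])
    show "0 \<le> N (x - y)" if "y \<in> R_set p a (ws n)" for n y
    proof -
      have "x - y \<in> H" using that xH R subspace_diff[OF H] by blast
      then show ?thesis using assms(8) by (simp add: norm_on_def)
    qed
    fix e :: real assume "e > 0"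
    then have "e / K > 0" using K(1) by simp
    then obtain s where s: "s \<in> S_set a w" and "dist (p s) x < e / K"
      using x unfolding R_set_def closure_approachable by blast
    then have "K * norm (x - p s) \<le> e"
      using K(1) by (simp add: dist_norm norm_minus_commute field_simps)
    moreover have "x - p s \<in> H" using xH p subspace_diff[OF H] by blast
    ultimately have close: "N (x - p s) \<le> e" using K(2) by force
    show "\<forall>\<^sub>F n in sequentially. \<exists>y\<in>R_set p a (ws n). N (x - y) \<le> e"
      using eventually_mem_S_set[OF assms(3) s]
    proof eventually_elim
      case (elim n)
      then have "p s \<in> R_set p a (ws n)"
        unfolding R_set_def using closure_subset by blast
      with close show ?case by blast
    qed
  qed
qed

end
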